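(* There is an absolute constant $C>0$ such that the following holds. Let $s\ge 2$, $l\ge 1$ be integers and $t$ an even positive integer with \[ t\ge C\,(\log s+\log l)\, l^2\left(1+s^{1/l}\right)^l. \] Then $\operatorname{ch}(K^s_{t/2,t/2})>l$.
   Context: A hypergraph $H=(V,E)$ has finite vertex set $V$ and edge set $E\subset 2^V$. $K^s_{n,m}$ denotes the complete 2-colorable $s$-uniform hypergraph with parts of sizes $n$ and $m$: its vertex set is a disjoint union $A\cup B$ with $|A|=n$, $|B|=m$, and its edges are all $s$-element subsets of $A\cup B$ meeting both $A$ and $B$. A coloring is proper if every edge contains two vertices of different colors. $H$ is $k$-choosable if for every assignment of lists $L(v)$ of colors with $|L(v)|=k$ for all $v$ there is a proper coloring assigning each $v$ a color from $L(v)$; $\operatorname{ch}(H)$ is the minimum such $k$. (The paper states the hypothesis as $t=\Omega\left((\log s+\log l)\, l^2(1+s^{1/l})^l\right)$.) *)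

theory Defs
  imports Complex_Main
begin

type_synonym 'a hypergraph = "'a set \<times> 'a set set"

definition hypergraph :: "'a hypergraph \<Rightarrow> bool" where
  "hypergraph H \<longleftrightarrow> finite (fst H) \<and> snd H \<subseteq> Pow (fst H)"

definition proper_coloring :: "'a hypergraph \<Rightarrow> ('a \<Rightarrow> 'c) \<Rightarrow> bool" where
  "proper_coloring H c \<longleftrightarrow> (\<forall>e\<in>snd H. \<exists>u\<in>e. \<exists>v\<in>e. c u \<noteq> c v)"

text \<open>Colors are natural numbers. This loses nothing: the vertex set is finite, so any
  assignment of finite lists uses only finitely many colors. Finiteness of the lists is
  explicit because \<open>card\<close> is 0 on infinite sets.\<close>

definition choosable :: "nat \<Rightarrow> 'a hypergraph \<Rightarrow> bool" where
  "choosable k H \<longleftrightarrow>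
     (\<forall>L :: 'a \<Rightarrow> nat set.
        (\<forall>v\<in>fst H. finite (L v) \<and> card (L v) = k) \<longrightarrow>
        (\<exists>c. proper_coloring H c \<and> (\<forall>v\<in>fst H. c v \<in> L v)))"

definition ch :: "'a hypergraph \<Rightarrow> nat" where
  "ch H = (LEAST k. choosable k H)"

text \<open>The two parts are the two sides of a disjoint sum.\<close>

definition complete_2colorable :: "nat \<Rightarrow> nat \<Rightarrow> nat \<Rightarrow> (nat + nat) hypergraph" where
  "complete_2colorable s n m =
     (let A = Inl ` {..<n}; B = Inr ` {..<m} in
      (A \<union> B, {e. e \<subseteq> A \<union> B \<and> card e = s \<and> e \<inter> A \<noteq> {} \<and> e \<inter> B \<noteq> {}}))"

lemma hypergraph_complete_2colorable: "hypergraph (complete_2colorable s n m)"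
  by (auto simp: hypergraph_def complete_2colorable_def Let_def)

text \<open>The minimum defining \<^const>\<open>ch\<close> is over a nonempty set as soon as every edge has at
  least two vertices: lists as long as the number of vertices admit an injective choice.\<close>

lemma injective_choice:
  fixes L :: "'a \<Rightarrow> 'c set"
  assumes "finite V" "\<And>v. v \<in> V \<Longrightarrow> finite (L v) \<and> card V \<le> card (L v)"
  shows "\<exists>c. inj_on c V \<and> (\<forall>v\<in>V. c v \<in> L v)"
  using assms
proof (induction V rule: finite_induct)
  case empty
  show ?case by simp
next
  case (insert x V)
  have "\<And>v. v \<in> V \<Longrightarrow> finite (L v) \<and> card V \<le> card (L v)"
    using insert.prems insert.hyps by fastforce
  with insert.IH obtain c where c: "inj_on c V" "\<forall>v\<in>V. c v \<in> L v" by blast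
  have "card (c ` V) < card (L x)"
    using insert.prems[of x] insert.hyps card_image_le[of V c] by simp
  then have "\<not> L x \<subseteq> c ` V"
    using insert.hyps by (meson card_mono finite_imageI leD)
  then obtain a where a: "a \<in> L x" "a \<notin> c ` V" by blast
  have "inj_on (c(x := a)) (insert x V)"
    using c(1) a(2) insert.hyps by (auto simp: inj_on_def)
  moreover have "\<forall>v\<in>insert x V. (c(x := a)) v \<in> L v"
    using c(2) a(1) by simp
  ultimately show ?case by blast
qed

lemma choosable_card_vertices:
  assumes "hypergraph H" "\<And>e. e \<in> snd H \<Longrightarrow> 2 \<le> card e"
  shows "choosable (card (fst H)) H"
  unfolding choosable_def
proof (intro allI impI)
  fix L :: "'a \<Rightarrow> nat set"
  assume L: "\<forall>v\<in>fst H. finite (L v) \<and> card (L v) = card (fst H)"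
  obtain c where c: "inj_on c (fst H)" "\<forall>v\<in>fst H. c v \<in> L v"
    using injective_choice[of "fst H" L] assms(1) L by (auto simp: hypergraph_def)
  have "\<exists>u\<in>e. \<exists>v\<in>e. c u \<noteq> c v" if e: "e \<in> snd H" for e
  proof -
    from assms(2)[OF e] obtain u v where "u \<in> e" "v \<in> e" "u \<noteq> v"
      by (metis card_le_Suc0_iff_eq card.infinite not_less_eq_eq numeral_2_eq_2 le0)
    moreover have "e \<subseteq> fst H" using assms(1) e by (auto simp: hypergraph_def)
    ultimately show ?thesis using c(1) by (meson inj_onD subsetD)
  qed
  with c(2) show "\<exists>c. proper_coloring H c \<and> (\<forall>v\<in>fst H. c v \<in> L v)"
    unfolding proper_coloring_def by blast
qed

end

theory Submission
  imports Defs
begin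

text \<open>Write \<open>a = s\<^sup>1\<^sup>/\<^sup>l\<close>. Draw the lists on both sides as random \<open>l\<close>-subsets of \<open>m\<close> colors and let
  \<open>P\<close> be the set of colors that a proper coloring does not use on the side \<open>B\<close>. No list of
  \<open>B\<close> lies inside \<open>P\<close>, while every color outside \<open>P\<close> occurs on \<open>B\<close>, hence fewer than \<open>s\<close> times
  on \<open>A\<close>, so at most \<open>s m\<close> lists of \<open>A\<close> avoid \<open>P\<close>. If \<open>P\<close> has density \<open>x\<close>, about \<open>n x\<^sup>l\<close> lists of \<open>B\<close>
  lie inside \<open>P\<close> and about \<open>n (1 - x)\<^sup>l\<close> lists of \<open>A\<close> avoid it. Once \<open>n\<close> exceeds a multiple of
  \<open>m (1 + a)\<^sup>l\<close>, the first constraint fails for \<open>x \<ge> 1 / (1 + a)\<close> and the second for smaller \<open>x\<close>.\<close>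

section \<open>Selecting points that hit many sets often\<close>

text \<open>Derandomised Chernoff bound: a set \<open>Q\<close> hit \<open>j\<close> times has weight \<open>2\<^sup>-\<^sup>j\<close>, and the average
  choice of the next point shrinks the total weight by the factor \<open>1 - p / 2\<close>.\<close>

lemma exists_selection_small_weight:
  fixes U :: "'a set" and F :: "'a set set" and p :: real
  assumes "finite U" "U \<noteq> {}" "finite F"
    and F: "\<And>Q. Q \<in> F \<Longrightarrow> Q \<subseteq> U \<and> p * card U \<le> card Q" and "p \<le> 1"
  shows "\<exists>f. (\<forall>i. f i \<in> U) \<and>
    (\<Sum>Q\<in>F. (1/2) ^ card {i. i < n \<and> f i \<in> Q}) \<le> card F * (1 - p / 2) ^ n"
proof (induction n)
  case 0
  then show ?case using \<open>U \<noteq> {}\<close> by auto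
next
  case (Suc n)
  then obtain f :: "nat \<Rightarrow> 'a" where f: "\<forall>i. f i \<in> U"
    and le: "(\<Sum>Q\<in>F. (1/2) ^ card {i. i < n \<and> f i \<in> Q}) \<le> card F * (1 - p / 2) ^ n" by blast
  define w where "w Q = (1/2::real) ^ card {i. i < n \<and> f i \<in> Q}" for Q
  \<comment> \<open>\<open>h u\<close> is the total weight after appending \<open>u\<close> as point
    number \<open>n\<close>; averaging it over \<open>U\<close> yields a choice no worse than the
    mean.\<close>
  define h where "h u = (\<Sum>Q\<in>F. w Q * (if u \<in> Q then 1/2 else 1))" for u
  have inner: "(\<Sum>u\<in>U. w Q * (if u \<in> Q then 1/2 else 1)) \<le> w Q * (card U * (1 - p / 2))"
    if "Q \<in> F" for Q
  proof -
    have "(\<Sum>u\<in>U. if u \<in> Q then 1/2 else (1::real)) = (\<Sum>u\<in>U. 1 - (if u \<in> Q then 1/2 else 0))"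
      by (rule sum.cong) auto
    also have "\<dots> = card U - card (U \<inter> Q) / 2"
      using \<open>finite U\<close> by (simp add: sum_subtractf flip: sum.inter_restrict)
    also have "U \<inter> Q = Q" using F[OF that] by blast
    also have "card U - card Q / 2 \<le> card U * (1 - p / 2)"
      using F[OF that] by (simp add: algebra_simps)
    finally show ?thesis
      by (simp add: w_def mult_left_mono flip: sum_distrib_left)
  qed
  have "(\<Sum>u\<in>U. h u) = (\<Sum>Q\<in>F. \<Sum>u\<in>U. w Q * (if u \<in> Q then 1/2 else 1))"
    unfolding h_def by (rule sum.swap)
  also have "\<dots> \<le> (\<Sum>Q\<in>F. w Q * (card U * (1 - p / 2)))"
    by (rule sum_mono) (rule inner)
  also have "\<dots> = card U * ((1 - p / 2) * (\<Sum>Q\<in>F. w Q))"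
    by (simp add: sum_distrib_right[symmetric])
  finally have "(\<Sum>u\<in>U. h u) \<le> (\<Sum>u\<in>U. (1 - p / 2) * (\<Sum>Q\<in>F. w Q))" by simp
  then obtain u where u: "u \<in> U" "h u \<le> (1 - p / 2) * (\<Sum>Q\<in>F. w Q)"
    using sum_strict_mono[of U "\<lambda>_. (1 - p / 2) * (\<Sum>Q\<in>F. w Q)" h] \<open>finite U\<close> \<open>U \<noteq> {}\<close>
    by (meson not_le)
  have "{i. i < Suc n \<and> (f(n := u)) i \<in> Q} =
      (if u \<in> Q then insert n {i. i < n \<and> f i \<in> Q} else {i. i < n \<and> f i \<in> Q})" for Q
    by (auto simp: less_Suc_eq)
  then have "(1/2) ^ card {i. i < Suc n \<and> (f(n := u)) i \<in> Q} =
      w Q * (if u \<in> Q then 1/2 else 1)" for Q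
    by (simp add: w_def)
  then have "(\<Sum>Q\<in>F. (1/2) ^ card {i. i < Suc n \<and> (f(n := u)) i \<in> Q}) = h u"
    by (simp add: h_def)
  also note u(2)
  also have "(1 - p / 2) * (\<Sum>Q\<in>F. w Q) \<le> (1 - p / 2) * (card F * (1 - p / 2) ^ n)"
    using le \<open>p \<le> 1\<close> by (intro mult_left_mono) (auto simp: w_def)
  finally have "(\<Sum>Q\<in>F. (1/2) ^ card {i. i < Suc n \<and> (f(n := u)) i \<in> Q})
      \<le> card F * (1 - p / 2) ^ Suc n" by (simp add: mult_ac)
  moreover have "\<forall>i. (f(n := u)) i \<in> U" using f u(1) by simp
  ultimately show ?case by blast
qed

text \<open>A set hit at most \<open>T\<close> times would alone contribute 2^(-T) to the total
  weight. Since 1 - p/2 \<le> exp(-p/2), hypothesis \<open>small\<close> keeps the whole weight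
  below that.\<close>

lemma exists_selection_hitting:
  fixes U :: "'a set" and F :: "'a set set" and p :: real and n :: nat
  assumes "finite U" "U \<noteq> {}" "finite F"
    and F: "\<And>Q. Q \<in> F \<Longrightarrow> Q \<subseteq> U \<and> p * card U \<le> card Q" and "p \<le> 1"
    and small: "card F * 2 ^ T * exp (- (n * p / 2)) < 1"
  shows "\<exists>f. (\<forall>i. f i \<in> U) \<and> (\<forall>Q\<in>F. T < card {i. i < n \<and> f i \<in> Q})"
proof -
  obtain f where f: "\<forall>i. f i \<in> U"
    and le: "(\<Sum>Q\<in>F. (1/2) ^ card {i. i < n \<and> f i \<in> Q}) \<le> card F * (1 - p / 2) ^ n"
    using exists_selection_small_weight[OF assms(1-5)] by blast
  have "(1 - p / 2) ^ n \<le> exp (- (p / 2)) ^ n"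
    using \<open>p \<le> 1\<close> exp_ge_add_one_self[of "- (p / 2)"] by (intro power_mono) auto
  also have "\<dots> = exp (- (n * p / 2))" by (simp flip: exp_of_nat_mult)
  finally have "card F * (1 - p / 2) ^ n \<le> card F * exp (- (n * p / 2))"
    by (intro mult_left_mono) auto
  also have "\<dots> < (1/2) ^ T"
    using small by (simp add: field_simps)
  finally have lt: "card F * (1 - p / 2) ^ n < (1/2) ^ T" .
  have "T < card {i. i < n \<and> f i \<in> Q}" if "Q \<in> F" for Q
  proof (rule ccontr)
    assume "\<not> T < card {i. i < n \<and> f i \<in> Q}"
    then have "(1/2::real) ^ T \<le> (1/2) ^ card {i. i < n \<and> f i \<in> Q}"
      by (intro power_decreasing) auto
    also have "\<dots> \<le> (\<Sum>Q\<in>F. (1/2) ^ card {i. i < n \<and> f i \<in> Q})"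
      using that \<open>finite F\<close> by (intro member_le_sum) auto
    finally show False using le lt by simp
  qed
  with f show ?thesis by blast
qed

text \<open>The quotient of the binomials is the product of (k - i)/(m - i) over i < l. As i \<le>
  k/(2l), each factor is at least (k/m)(1 - 1/(2l)), and Bernoulli bounds (1 - 1/(2l))^l below by
  1/2.\<close>

lemma binomial_ratio_ge:
  fixes k l m :: nat
  assumes "1 \<le> l" "2 * l\<^sup>2 \<le> k" "k \<le> m"
  shows "(real k / real m) ^ l / 2 * (m choose l) \<le> (k choose l)"
proof -
  have "l \<le> l\<^sup>2" using \<open>1 \<le> l\<close> by (simp add: power2_eq_square)
  then have lk: "l \<le> k" "l \<le> m" and k0: "0 < k" "0 < m" using assms by linarith+
  have "(1::real) / 2 \<le> 1 + real l * (- (1 / (2 * l)))" using \<open>1 \<le> l\<close> by simp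
  also have "\<dots> \<le> (1 + (- (1 / (2 * l)))) ^ l"
    using \<open>1 \<le> l\<close> by (intro Bernoulli_inequality) (simp add: field_simps)
  finally have half: "(1::real) / 2 \<le> (1 - 1 / (2 * l)) ^ l" by simp
  have choose: "real (q choose l) = (\<Prod>i=0..<l. (real q - i) / (real l - i))" if "l \<le> q" for q
    unfolding binomial_altdef_of_nat[OF that] using that
    by (intro prod.cong refl) (simp add: of_nat_diff)
  have "(real k / m) ^ l / 2 * (m choose l) \<le> (real k / m) ^ l * (1 - 1 / (2 * l)) ^ l * (m choose l)"
    using mult_left_mono[OF half, of "(real k / m) ^ l * (m choose l)"] by (simp add: mult_ac)
  also have "\<dots> = (\<Prod>i=0..<l. (k - k / (2 * l)) / m * ((real m - i) / (real l - i)))"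
  proof -
    have "(k - k / (2 * l)) / m = real k / m * (1 - 1 / (2 * l))"
      by (simp add: algebra_simps diff_divide_distrib)
    then show ?thesis
      unfolding prod.distrib choose[OF \<open>l \<le> m\<close>]
      by (simp only: power_mult_distrib prod_constant card_atLeastLessThan diff_zero)
  qed
  also have "\<dots> \<le> (\<Prod>i=0..<l. (real k - i) / (real l - i))"
  proof (rule prod_mono)
    fix i assume "i \<in> {0..<l}"
    then have i: "i < l" by simp
    have "real i * (2 * l) \<le> 2 * (real l)\<^sup>2"
      using i by (simp add: power2_eq_square)
    also have "\<dots> \<le> k" using assms(2) by (metis of_nat_le_iff of_nat_mult of_nat_numeral of_nat_power)
    finally have "i \<le> k / (2 * l)" using \<open>1 \<le> l\<close> by (simp add: field_simps)
    moreover have "k / (2 * l) \<le> real k / 1" using \<open>1 \<le> l\<close> by (intro divide_left_mono) auto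
    then have "0 \<le> k - k / (2 * l)" by simp
    ultimately have "(k - k / (2 * l)) * (real m - i) \<le> (real k - i) * m"
      using i lk by (intro mult_mono) auto
    then have "(k - k / (2 * l)) / m * (real m - i) \<le> real k - i"
      using k0 by (simp add: field_simps)
    then show "0 \<le> (k - k / (2 * l)) / m * ((real m - i) / (real l - i)) \<and>
        (k - k / (2 * l)) / m * ((real m - i) / (real l - i)) \<le> (real k - i) / (real l - i)"
      using i lk \<open>0 \<le> k - k / (2 * l)\<close>
        divide_right_mono[of "(k - k / (2 * l)) / m * (real m - i)" "real k - i" "real l - i"]
      by auto
  qed
  also have "\<dots> = (k choose l)"
    using \<open>l \<le> k\<close> by (simp add: choose)
  finally show ?thesis .
qed

text \<open>The points to select are the \<open>l\<close>-subsets of the \<open>m\<close> colors,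
  and the sets to hit are the families \<open>S P\<close> with \<open>card P = k\<close>. Each has
  density at least \<open>p\<close>, and a union bound over at most 2^m of them suffices.\<close>

lemma exists_lists_in_subsets:
  fixes k l m n T :: nat
  assumes "1 \<le> l" "2 * l\<^sup>2 \<le> k" "k \<le> m" "1 \<le> T + m"
    and n: "4 * real (T + m) \<le> n * (real k / real m) ^ l"
  shows "\<exists>f :: nat \<Rightarrow> nat set. (\<forall>i. f i \<subseteq> {..<m} \<and> card (f i) = l) \<and>
    (\<forall>P \<subseteq> {..<m}. card P = k \<longrightarrow> T < card {i. i < n \<and> f i \<subseteq> P})"
proof -
  define S where "S P = {X. X \<subseteq> P \<and> card X = l}" for P :: "nat set"
  define F where "F = S ` {P. P \<subseteq> {..<m} \<and> card P = k}"
  define p where "p = (real k / real m) ^ l / 2"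
  have "l \<le> l\<^sup>2" using \<open>1 \<le> l\<close> by (simp add: power2_eq_square)
  then have "l \<le> m" using assms by linarith
  have cardS: "card (S P) = (card P choose l)" if "P \<subseteq> {..<m}" for P
    unfolding S_def using that finite_subset by (intro n_subsets) blast
  have "finite (S {..<m})" unfolding S_def by simp
  have "S {..<m} \<noteq> {}" using cardS[of "{..<m}"] \<open>l \<le> m\<close> by (auto simp: card_gt_0_iff)
  have "finite {P. P \<subseteq> {..<m} \<and> card P = k}" by simp
  then have "finite F" unfolding F_def by simp
  have "card F \<le> card {P. P \<subseteq> {..<m} \<and> card P = k}" unfolding F_def by (intro card_image_le) simp
  also have "\<dots> \<le> card (Pow {..<m})" by (intro card_mono) auto
  finally have "card F \<le> 2 ^ m" by (simp add: card_Pow)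
  then have "real (card F) \<le> 2 ^ m" using of_nat_mono by fastforce
  then have "card F * 2 ^ T \<le> (2::real) ^ (T + m)" by (simp add: power_add mult_ac)
  \<comment> \<open>Replacing 2 by e absorbs both 2^m and 2^T; the factor 4 in \<open>n\<close>
    makes n p/2 at least T + m.\<close>
  also have "\<dots> < exp 1 ^ (T + m)"
    using assms(4) exp_lower_Taylor_quadratic[of 1]
    by (intro power_strict_mono) auto
  also have "\<dots> = exp (real (T + m))" by (simp flip: exp_of_nat_mult)
  also have "\<dots> \<le> exp (n * p / 2)" using n by (simp add: p_def)
  finally have small: "card F * 2 ^ T * exp (- (n * p / 2)) < 1"
    by (simp add: exp_minus field_simps)
  have "(real k / m) ^ l \<le> 1" using \<open>k \<le> m\<close> by (intro power_le_one) (auto simp: divide_le_eq_1)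
  then have "p \<le> 1" unfolding p_def by simp
  have "Q \<subseteq> S {..<m} \<and> p * card (S {..<m}) \<le> card Q" if "Q \<in> F" for Q
    using that binomial_ratio_ge[OF assms(1-3)] cardS unfolding F_def p_def
    by (auto simp: S_def)
  from exists_selection_hitting[OF \<open>finite (S {..<m})\<close> \<open>S {..<m} \<noteq> {}\<close> \<open>finite F\<close> this \<open>p \<le> 1\<close> small]
  obtain f where f: "\<forall>i. f i \<in> S {..<m}" "\<forall>Q\<in>F. T < card {i. i < n \<and> f i \<in> Q}" by blast
  have "T < card {i. i < n \<and> f i \<subseteq> P}" if "P \<subseteq> {..<m}" "card P = k" for P
  proof -
    have "f i \<in> S P \<longleftrightarrow> f i \<subseteq> P" for i using f(1) by (auto simp: S_def)
    moreover have "S P \<in> F" using that by (auto simp: F_def)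
    ultimately show ?thesis using f(2) by fastforce
  qed
  with f(1) show ?thesis unfolding S_def by blast
qed

section \<open>Choosability\<close>

lemma choosable_mono:
  assumes "choosable k H" "k \<le> l"
  shows "choosable l H"
  unfolding choosable_def
proof (intro allI impI)
  fix L :: "'a \<Rightarrow> nat set"
  assume L: "\<forall>v\<in>fst H. finite (L v) \<and> card (L v) = l"
  have "\<forall>v\<in>fst H. \<exists>M. M \<subseteq> L v \<and> finite M \<and> card M = k"
    using L \<open>k \<le> l\<close> by (metis obtain_subset_with_card_n finite_subset)
  then obtain M where M: "\<forall>v\<in>fst H. M v \<subseteq> L v \<and> finite (M v) \<and> card (M v) = k" by metis
  then obtain c where "proper_coloring H c" "\<forall>v\<in>fst H. c v \<in> M v"
    using assms(1) unfolding choosable_def by blast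
  with M show "\<exists>c. proper_coloring H c \<and> (\<forall>v\<in>fst H. c v \<in> L v)" by blast
qed

text \<open>Monotonicity turns failure at the single length \<open>l\<close> into failure at all
  shorter lengths, and the vertex count witnesses that the \<open>LEAST\<close> is attained.\<close>

lemma ch_greater:
  assumes "hypergraph H" "\<And>e. e \<in> snd H \<Longrightarrow> 2 \<le> card e" "\<not> choosable l H"
  shows "l < ch H"
proof (rule ccontr)
  assume "\<not> l < ch H"
  moreover have "choosable (ch H) H"
    unfolding ch_def
    using LeastI[of "\<lambda>k. choosable k H"] choosable_card_vertices[OF assms(1,2)] by simp
  ultimately show False using choosable_mono assms(3) by (metis not_le)
qed

text \<open>Any s - 1 left vertices of color \<open>x\<close>, together with \<open>Inr j\<close>,
  would form a monochromatic edge. The slightly weaker bound \<open>s\<close> is enough.\<close>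

lemma proper_coloring_color_class_bound:
  assumes c: "proper_coloring (complete_2colorable s n m) c" and "2 \<le> s"
    and j: "j < m" "c (Inr j) = x"
  shows "card {i. i < n \<and> c (Inl i) = x} \<le> s"
proof (rule ccontr)
  assume "\<not> ?thesis"
  then have "s - 1 \<le> card {i. i < n \<and> c (Inl i) = x}" by simp
  then obtain X where X: "X \<subseteq> {i. i < n \<and> c (Inl i) = x}" "card X = s - 1" "finite X"
    by (rule obtain_subset_with_card_n)
  define e :: "(nat + nat) set" where "e = insert (Inr j) (Inl ` X)"
  have "X \<noteq> {}" using X(2) \<open>2 \<le> s\<close> by auto
  have "card e = s"
    using X \<open>2 \<le> s\<close> by (simp add: e_def card_image image_iff)
  moreover have "e \<subseteq> Inl ` {..<n} \<union> Inr ` {..<m}" using X(1) j(1) by (auto simp: e_def)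
  moreover obtain i where "i \<in> X" "i < n" using X(1) \<open>X \<noteq> {}\<close> by blast
  then have "e \<inter> Inl ` {..<n} \<noteq> {}" "e \<inter> Inr ` {..<m} \<noteq> {}"
    using j(1) unfolding e_def by blast+
  ultimately have "e \<in> snd (complete_2colorable s n m)"
    by (simp add: complete_2colorable_def Let_def)
  moreover have "c u = x" if "u \<in> e" for u
    using that X(1) j(2) by (auto simp: e_def)
  ultimately show False using c unfolding proper_coloring_def by metis
qed

lemma not_choosable_if_lists:
  fixes f g :: "nat \<Rightarrow> nat set"
  assumes "2 \<le> s" "k \<le> m"
    and f: "\<And>i. f i \<subseteq> {..<m} \<and> card (f i) = l"
    and g: "\<And>j. g j \<subseteq> {..<m} \<and> card (g j) = l"
    and many: "\<And>Q. Q \<subseteq> {..<m} \<Longrightarrow> card Q = m - k \<Longrightarrow> s * m < card {i. i < n \<and> f i \<subseteq> Q}"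
    and one: "\<And>P. P \<subseteq> {..<m} \<Longrightarrow> card P = k \<Longrightarrow> 0 < card {j. j < n \<and> g j \<subseteq> P}"
  shows "\<not> choosable l (complete_2colorable s n n)"
proof
  let ?H = "complete_2colorable s n n"
  assume "choosable l ?H"
  moreover have "finite (f i)" "finite (g i)" for i
    using f g by (meson finite_lessThan finite_subset)+
  then have "finite (case_sum f g v) \<and> card (case_sum f g v) = l" for v
    using f g by (cases v) simp_all
  ultimately have "\<exists>c. proper_coloring ?H c \<and> (\<forall>v\<in>fst ?H. c v \<in> case_sum f g v)"
    unfolding choosable_def by (elim allE[of _ "case_sum f g"]) simp
  then obtain c where c: "proper_coloring ?H c"
    and L: "\<forall>v\<in>fst ?H. c v \<in> case_sum f g v"
    by blast
  have "fst ?H = Inl ` {..<n} \<union> Inr ` {..<n}" by (simp add: complete_2colorable_def Let_def)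
  then have cf: "\<And>i. i < n \<Longrightarrow> c (Inl i) \<in> f i" and cg: "\<And>j. j < n \<Longrightarrow> c (Inr j) \<in> g j"
    using bspec[OF L, of "Inl _"] bspec[OF L, of "Inr _"] by auto
  define P where "P = {x. x < m \<and> (\<forall>j<n. c (Inr j) \<noteq> x)}"
  have "P \<subseteq> {..<m}" by (auto simp: P_def)
  show False
  proof (cases "k \<le> card P")
    case True
    then obtain P' where P': "P' \<subseteq> P" "card P' = k" by (metis obtain_subset_with_card_n)
    have "0 < card {j. j < n \<and> g j \<subseteq> P'}"
      using P' \<open>P \<subseteq> {..<m}\<close> by (intro one) auto
    then have "{j. j < n \<and> g j \<subseteq> P'} \<noteq> {}" by (metis card.empty less_irrefl)
    then obtain j where "j < n" "g j \<subseteq> P'" by blast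
    then show False using cg P'(1) unfolding P_def by blast
  next
    case False
    have "card ({..<m} - P) = m - card P"
      using \<open>P \<subseteq> {..<m}\<close> by (simp add: card_Diff_subset finite_subset)
    then have "m - k \<le> card ({..<m} - P)" using False by simp
    then obtain Q where Q: "Q \<subseteq> {..<m} - P" "card Q = m - k" "finite Q"
      by (metis obtain_subset_with_card_n)
    \<comment> \<open>A left vertex whose list lies in \<open>Q\<close> gets its color from
      \<open>Q\<close>, and each color of \<open>Q\<close> is used on the right, so its left class
      is small.\<close>
    have "card {i. i < n \<and> f i \<subseteq> Q} \<le> card (\<Union>x\<in>Q. {i. i < n \<and> c (Inl i) = x})"
      using cf Q(3) by (intro card_mono) auto
    also have "\<dots> \<le> (\<Sum>x\<in>Q. card {i. i < n \<and> c (Inl i) = x})"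
      using Q(3) by (rule card_UN_le)
    also have "\<dots> \<le> (\<Sum>x\<in>Q. s)"
    proof (rule sum_mono)
      fix x assume "x \<in> Q"
      then obtain j where "j < n" "c (Inr j) = x" using Q(1) by (auto simp: P_def)
      then show "card {i. i < n \<and> c (Inl i) = x} \<le> s"
        using proper_coloring_color_class_bound[OF c \<open>2 \<le> s\<close>] by blast
    qed
    also have "\<dots> \<le> s * m" using Q(2) by simp
    finally show False using many[of Q] Q by auto
  qed
qed

section \<open>Choice of the parameters\<close>

text \<open>This is the source of the logarithmic factor. If the root is at most 2, the constant 4
  ln 2 \<ge> 2 suffices; otherwise l ln 2 \<le> ln s bounds the other argument of the
  minimum.\<close>

lemma min_powr_inverse_le_ln:
  fixes s l :: nat
  assumes "2 \<le> s" "1 \<le> l"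
  shows "min (real s powr (1 / l)) l \<le> 4 * (ln s + ln l)"
proof -
  have ln2: "(1::real) / 2 \<le> ln 2" using ln_le_minus_one[of "1 / 2"] by (simp add: ln_div)
  have "ln 2 \<le> ln (real s)" and "0 \<le> ln (real l)" using assms by auto
  show ?thesis
  proof (cases "real s powr (1 / l) \<le> 2")
    case True
    then have "min (real s powr (1 / l)) l \<le> 2" by (simp add: min_le_iff_disj)
    also have "2 \<le> 4 * (ln s + ln l)" using ln2 \<open>ln 2 \<le> ln (real s)\<close> \<open>0 \<le> ln (real l)\<close> by argo
    finally show ?thesis .
  next
    case False
    then have "ln 2 \<le> ln (real s powr (1 / l))" using assms by (subst ln_le_cancel_iff) auto
    also have "\<dots> = ln s / l" using assms by (simp add: ln_powr)
    finally have "ln 2 * l \<le> ln s" using assms by (simp add: field_simps)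
    moreover have "1 / 2 * real l \<le> ln 2 * l" using ln2 by (intro mult_right_mono) auto
    moreover have "0 \<le> real l" by simp
    ultimately have "l \<le> 4 * (ln s + ln l)" using \<open>0 \<le> ln (real l)\<close> by argo
    then show ?thesis by (simp add: min_le_iff_disj)
  qed
qed

text \<open>Without truncation, (1 + a) b/(1 + b) is exactly \<open>a\<close>. With b = l, the power
  of b/(1 + b) is (1 + 1/l)^(-l) \<ge> 1/e \<ge> 1/3.\<close>

lemma truncated_ratio_power_ge:
  fixes a b :: real and l :: nat
  assumes "1 \<le> a" "1 \<le> l" "b = min a l"
  shows "a ^ l / 3 \<le> (1 + a) ^ l * (b / (1 + b)) ^ l"
proof (cases "a \<le> l")
  case True
  then have "b = a" using assms by simp
  then have "(1 + a) ^ l * (b / (1 + b)) ^ l = a ^ l"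
    using \<open>1 \<le> a\<close> by (simp add: power_divide)
  then show ?thesis using \<open>1 \<le> a\<close> by simp
next
  case False
  then have b: "b = l" using assms by simp
  have "(1 + 1 / real l) ^ l \<le> exp (1 / real l) ^ l"
    by (intro power_mono) auto
  also have "\<dots> = exp 1" using \<open>1 \<le> l\<close> by (simp flip: exp_of_nat_mult)
  also have "\<dots> \<le> 3" by (rule exp_le)
  finally have "1 / 3 \<le> 1 / (1 + 1 / real l) ^ l"
    using \<open>1 \<le> l\<close> by (simp add: field_simps add_pos_pos)
  also have "\<dots> = (b / (1 + b)) ^ l"
    using \<open>1 \<le> l\<close> by (simp add: b field_simps flip: power_one_over power_divide)
  finally have "1 / 3 \<le> (b / (1 + b)) ^ l" .
  moreover have "a ^ l \<le> (1 + a) ^ l" using \<open>1 \<le> a\<close> by (intro power_mono) auto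
  ultimately have "a ^ l * (1 / 3) \<le> (1 + a) ^ l * (b / (1 + b)) ^ l"
    using \<open>1 \<le> a\<close> by (intro mult_mono) auto
  then show ?thesis by simp
qed

text \<open>The density must stay above \<open>1 / (1 + l)\<close>: sets of density \<open>1 / (1 + b)\<close> need size at least
  \<open>2 l\<^sup>2\<close> for \<open>binomial_ratio_ge\<close>, whereas \<open>m\<close> may only be of order \<open>l\<^sup>2 (ln s + ln l)\<close>. Truncating \<open>a\<close>
  at \<open>l\<close> costs only the factor \<open>(1 + 1 / l)\<^sup>l \<le> 3\<close>.\<close>

lemma not_choosable_complete_2colorable:
  fixes s l n :: nat
  assumes "2 \<le> s" "1 \<le> l"
    and n: "576 * (ln s + ln l) * (real l)\<^sup>2 * (1 + real s powr (1 / l)) ^ l \<le> n"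
  shows "\<not> choosable l (complete_2colorable s n n)"
proof -
  define a where "a = real s powr (1 / l)"
  define b where "b = min a l"
  define k where "k = 2 * l\<^sup>2"
  \<comment> \<open>Rounding up puts k/m at or just below 1/(1 + b), so the complementary density is
    at least b/(1 + b) with no loss.\<close>
  define m where "m = nat \<lceil>k * (1 + b)\<rceil>"
  have "1 \<le> a" unfolding a_def using assms by (intro ge_one_powr_ge_zero) auto
  have "a powr l = s" using assms by (simp add: a_def powr_powr)
  then have "a ^ l = s" using \<open>1 \<le> a\<close> by (simp add: powr_realpow)
  have "1 \<le> b" "b \<le> a" using \<open>1 \<le> a\<close> \<open>1 \<le> l\<close> by (auto simp: b_def)
  have l2: "1 \<le> (real l)\<^sup>2" "real l \<le> (real l)\<^sup>2"
    using \<open>1 \<le> l\<close> by (auto simp: one_le_power self_le_power)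
  have rk: "real k = 2 * (real l)\<^sup>2" by (simp add: k_def)
  have "0 \<le> k * (1 + b)" using \<open>1 \<le> b\<close> by simp
  then have m: "k * (1 + b) \<le> m" "m \<le> k * (1 + b) + 1"
    unfolding m_def by linarith+
  have "real k * 2 \<le> k * (1 + b)" using \<open>1 \<le> b\<close> by (intro mult_left_mono) auto
  then have "2 * k \<le> m" using m(1) by linarith
  have "0 < k" using \<open>1 \<le> l\<close> by (simp add: k_def)
  have "m \<le> 6 * (real l)\<^sup>2 * b"
  proof -
    have "1 * 1 \<le> (real l)\<^sup>2 * b" "(real l)\<^sup>2 * 1 \<le> (real l)\<^sup>2 * b"
      using l2 \<open>1 \<le> b\<close> by (intro mult_mono; simp)+
    then show ?thesis using m(2) by (simp add: rk algebra_simps)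
  qed
  also have "\<dots> \<le> 6 * (real l)\<^sup>2 * (4 * (ln s + ln l))"
    using min_powr_inverse_le_ln[OF assms(1,2)] by (intro mult_left_mono) (auto simp: a_def b_def)
  \<comment> \<open>Here 576 = 24 * 6 * 4. The 24 pays for the factor 3 of the truncation and for 8
    s m \<ge> 4 (s m + m).\<close>
  finally have "24 * m \<le> 576 * (ln s + ln l) * (real l)\<^sup>2" by (simp add: algebra_simps)
  then have "24 * m * (1 + a) ^ l \<le> 576 * (ln s + ln l) * (real l)\<^sup>2 * (1 + a) ^ l"
    using \<open>1 \<le> a\<close> by (intro mult_right_mono) auto
  then have n': "24 * m * (1 + a) ^ l \<le> n" using n by (simp add: a_def)
  have "m - k \<le> m" "k \<le> m" "2 * l\<^sup>2 \<le> k" "2 * l\<^sup>2 \<le> m - k" "0 < m"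
    using \<open>2 * k \<le> m\<close> \<open>0 < k\<close> unfolding k_def by linarith+
  \<comment> \<open>Right side, with threshold T = 0.\<close>
  have "4 * real (0 + m) \<le> n * (real k / real m) ^ l"
  proof -
    have "2 * real l \<le> k * (1 + b)"
      using \<open>real k * 2 \<le> k * (1 + b)\<close> l2(2) rk by linarith
    \<comment> \<open>The rounding error 1 is at most m/(2l), so it costs only a factor 1/2 after
      taking the \<open>l\<close>-th power.\<close>
    have "m * (1 - 1 / (2 * l)) \<le> k * (1 + b)"
    proof -
      have "1 \<le> real m / (2 * l)"
        using m(1) \<open>2 * real l \<le> k * (1 + b)\<close> \<open>1 \<le> l\<close> by (simp add: field_simps)
      then show ?thesis using m(2) by (simp add: algebra_simps)
    qed
    then have "(1 - 1 / (2 * l)) / (1 + b) \<le> k / m"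
      using \<open>1 \<le> b\<close> \<open>0 < m\<close> by (simp add: field_simps)
    then have "((1 - 1 / (2 * l)) / (1 + b)) ^ l \<le> (k / m) ^ l"
      using \<open>1 \<le> b\<close> \<open>1 \<le> l\<close> by (intro power_mono) (auto simp: field_simps)
    moreover have "(1::real) / 2 \<le> (1 - 1 / (2 * l)) ^ l"
      using Bernoulli_inequality[of "- (1 / (2 * real l))" l] \<open>1 \<le> l\<close> by (simp add: field_simps)
    then have "1 / 2 / (1 + b) ^ l \<le> ((1 - 1 / (2 * l)) / (1 + b)) ^ l"
      unfolding power_divide using \<open>1 \<le> b\<close> by (intro divide_right_mono) auto
    ultimately have "1 / 2 / (1 + b) ^ l \<le> (k / m) ^ l" by linarith
    moreover have "(1 + b) ^ l \<le> (1 + a) ^ l" using \<open>b \<le> a\<close> \<open>1 \<le> b\<close> by (intro power_mono) auto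
    then have "24 * m * (1 + b) ^ l \<le> 24 * m * (1 + a) ^ l" by (intro mult_left_mono) auto
    with n' have "24 * m * (1 + b) ^ l \<le> n" by linarith
    ultimately have "24 * m * (1 + b) ^ l * (1 / 2 / (1 + b) ^ l) \<le> n * (k / m) ^ l"
      using \<open>1 \<le> b\<close> by (intro mult_mono) auto
    then show ?thesis using \<open>1 \<le> b\<close> by simp
  qed
  from exists_lists_in_subsets[OF \<open>1 \<le> l\<close> \<open>2 * l\<^sup>2 \<le> k\<close> \<open>k \<le> m\<close> _ this] \<open>0 < m\<close>
  obtain g :: "nat \<Rightarrow> nat set" where g: "\<forall>i. g i \<subseteq> {..<m} \<and> card (g i) = l"
    "\<forall>P \<subseteq> {..<m}. card P = k \<longrightarrow> 0 < card {i. i < n \<and> g i \<subseteq> P}"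
    by auto
  \<comment> \<open>Left side, with threshold T = s m.\<close>
  have "4 * real (s * m + m) \<le> n * (real (m - k) / real m) ^ l"
  proof -
    have "1 - k / m \<ge> b / (1 + b)"
      using m(1) \<open>1 \<le> b\<close> \<open>0 < m\<close> by (simp add: field_simps)
    then have "b / (1 + b) \<le> real (m - k) / m"
      using \<open>k \<le> m\<close> \<open>0 < m\<close> by (simp add: of_nat_diff diff_divide_distrib)
    then have "(b / (1 + b)) ^ l \<le> (real (m - k) / m) ^ l"
      using \<open>1 \<le> b\<close> by (intro power_mono) auto
    then have "24 * m * (1 + a) ^ l * (b / (1 + b)) ^ l \<le> n * (real (m - k) / m) ^ l"
      using n' \<open>1 \<le> b\<close> by (intro mult_mono) auto
    moreover have "24 * m * (a ^ l / 3) \<le> 24 * m * ((1 + a) ^ l * (b / (1 + b)) ^ l)"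
      using truncated_ratio_power_ge[OF \<open>1 \<le> a\<close> \<open>1 \<le> l\<close> b_def] by (intro mult_left_mono) auto
    ultimately have "8 * m * s \<le> n * (real (m - k) / m) ^ l"
      using \<open>a ^ l = s\<close> by (simp add: mult_ac)
    moreover have "real m * 1 \<le> real m * s" using \<open>2 \<le> s\<close> by (intro mult_left_mono) auto
    ultimately show ?thesis by (simp add: algebra_simps)
  qed
  from exists_lists_in_subsets[OF \<open>1 \<le> l\<close> \<open>2 * l\<^sup>2 \<le> m - k\<close> \<open>m - k \<le> m\<close> _ this] \<open>0 < m\<close>
  obtain f :: "nat \<Rightarrow> nat set" where f: "\<forall>i. f i \<subseteq> {..<m} \<and> card (f i) = l"
    "\<forall>P \<subseteq> {..<m}. card P = m - k \<longrightarrow> s * m < card {i. i < n \<and> f i \<subseteq> P}"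
    by auto
  show ?thesis
    by (rule not_choosable_if_lists[OF \<open>2 \<le> s\<close> \<open>k \<le> m\<close>, of f l g]) (use f g in auto)
qed

theorem theorem9:
  shows "\<exists>C::real. C > 0 \<and>
    (\<forall>s l t :: nat. s \<ge> 2 \<longrightarrow> l \<ge> 1 \<longrightarrow> t > 0 \<longrightarrow> even t \<longrightarrow>
      real t \<ge> C * (ln (real s) + ln (real l)) * (real l)^2 * (1 + real s powr (1 / real l)) ^ l \<longrightarrow>
      ch (complete_2colorable s (t div 2) (t div 2)) > l)"
\<comment> \<open>1152 = 2 * 576, as each side has t/2 vertices.\<close>
proof (intro exI[of _ 1152] conjI allI impI)
  fix s l t :: nat
  assume *: "s \<ge> 2" "l \<ge> 1" "even t"
    and t: "real t \<ge> 1152 * (ln (real s) + ln (real l)) * (real l)^2 *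
      (1 + real s powr (1 / real l)) ^ l"
  have "real t = 2 * real (t div 2)"
    using \<open>even t\<close> by (metis dvd_mult_div_cancel of_nat_mult of_nat_numeral)
  then have "\<not> choosable l (complete_2colorable s (t div 2) (t div 2))"
    using * t by (intro not_choosable_complete_2colorable) (auto simp: algebra_simps)
  moreover have "2 \<le> card e" if "e \<in> snd (complete_2colorable s (t div 2) (t div 2))" for e
    using that \<open>s \<ge> 2\<close> by (auto simp: complete_2colorable_def Let_def)
  ultimately show "ch (complete_2colorable s (t div 2) (t div 2)) > l"
    by (intro ch_greater hypergraph_complete_2colorable)
qed simp

end
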